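(* Let $(a,b)\in\mathcal P$. The region $\Theta_{a,b}=\Theta^u_{a,b}\cup\Theta^l_{a,b}\subset\bar{\mathbb R}^2\setminus\Delta$, consisting of two connected components (or one if $a=0$ or $b=0$) defined as $$\Theta^u_{a,b}=\begin{cases}[-\infty,-1]\times[b-1,\infty]\cup[-1,0]\times[-\frac1a,\infty]&\text{if }b\ge1,\ a\ne0\\ \emptyset&\text{if }a=0\\ [-\infty,-1]\times[b-1,\infty]\cup[-1,0]\times[\min(-\frac{b}{b-1},-\frac1a),\infty]\cup[0,1]\times[-\frac1{b-1},\infty]&\text{if }0\le b<1\end{cases}$$ $$\Theta^l_{a,b}=\begin{cases}[0,1]\times[-\infty,-\frac1b]\cup[1,\infty]\times[-\infty,a+1]&\text{if }a\le-1,\ b\ne0\\ \emptyset&\text{if }b=0\\ [-1,0]\times[-\infty,-\frac1{a+1}]\cup[0,1]\times[-\infty,\max(\frac a{a+1},-\frac1b)]\cup[1,\infty]\times[-\infty,a+1]&\text{if }a>-1\end{cases}$$ is a trapping region for the map $F_{a,b}$; that is: (i) for every $(x,y)\in\bar{\mathbb R}^2\setminus\Delta$ there exists a positive integer $N$ such that $F_{a,b}^N(x,y)\in\Theta_{a,b}$; and (ii) $F_{a,b}(\Theta_{a,b})\subset\Theta_{a,b}$.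
   Context: $\bar{\mathbb R}=\mathbb R\cup\{\infty\}$, $\Delta=\{(x,y)\in\bar{\mathbb R}^2 : x=y\}$, $\mathcal P=\{(a,b)\in\mathbb R^2 : a\le 0\le b,\ b-a\ge 1,\ -ab\le 1\}$. The map $F_{a,b}:\bar{\mathbb R}^2\setminus\Delta\to\bar{\mathbb R}^2\setminus\Delta$ is $$F_{a,b}(x,y)=\begin{cases}(x+1,y+1)&\text{if } y<a\\ (-1/x,-1/y)&\text{if } a\le y<b\\ (x-1,y-1)&\text{if } y\ge b.\end{cases}$$ In intervals, $-\infty$ and $\infty$ both denote the point $\infty\in\bar{\mathbb R}$; all regions are regarded as (relatively closed) subsets of $\bar{\mathbb R}^2\setminus\Delta$, i.e. any points of $\Delta$ in the rectangles are removed.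
   Formalization: Components are taken in the plane, as both parts contain (0,∞) if a,b≠0. If a=0, points (x,0) with 0<x<1 and (x,∞) with x<0 are excluded from (i),(ii), which fail there; if b=a+1, 0<b<1, points (x,b) with 1≤x<2 are excluded from (ii), which fails there. *)

theory Defs
  imports "HOL-Analysis.Analysis"
begin

text \<open>The real line with a single point at infinity, as the one-point compactification of the
  reals: \<open>None\<close> is the point \<open>\<infinity> = - \<infinity>\<close>.\<close>

type_synonym rbar = "real option"

definition rbar2_top :: "(rbar \<times> rbar) topology" where
  "rbar2_top = prod_topology (Alexandroff_compactification euclideanreal)
                             (Alexandroff_compactification euclideanreal)"

definition off_diag :: "(rbar \<times> rbar) set" where
  "off_diag = {(x, y). x \<noteq> y}"

definition params :: "(real \<times> real) set" where
  "params = {(a, b). a \<le> 0 \<and> 0 \<le> b \<and> b - a \<ge> 1 \<and> - a * b \<le> 1}"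

definition translate :: "real \<Rightarrow> rbar \<Rightarrow> rbar" where
  "translate c = map_option (\<lambda>t. t + c)"

fun neg_recip :: "rbar \<Rightarrow> rbar" where
  "neg_recip None = Some 0"
| "neg_recip (Some t) = (if t = 0 then None else Some (- 1 / t))"

text \<open>In the case distinction defining the map, \<open>\<infinity>\<close> is not below any real number, so a point
  with second coordinate \<open>\<infinity>\<close> falls under the branch \<open>y \<ge> b\<close>.\<close>

definition below :: "rbar \<Rightarrow> real \<Rightarrow> bool" where
  "below y c \<longleftrightarrow> (case y of None \<Rightarrow> False | Some t \<Rightarrow> t < c)"

definition F :: "real \<Rightarrow> real \<Rightarrow> rbar \<times> rbar \<Rightarrow> rbar \<times> rbar" where
  "F a b = (\<lambda>(x, y).
     if below y a then (translate 1 x, translate 1 y)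
     else if below y b then (neg_recip x, neg_recip y)
     else (translate (- 1) x, translate (- 1) y))"

text \<open>The intervals \<open>[u, v]\<close>, \<open>[u, \<infinity>]\<close> and \<open>[- \<infinity>, v]\<close> with real \<open>u\<close>, \<open>v\<close>; the last two contain
  the point \<open>\<infinity>\<close>.\<close>

definition Icc :: "real \<Rightarrow> real \<Rightarrow> rbar set" where
  "Icc u v = Some ` {u..v}"

definition Ici :: "real \<Rightarrow> rbar set" where
  "Ici u = insert None (Some ` {u..})"

definition Iic :: "real \<Rightarrow> rbar set" where
  "Iic v = insert None (Some ` {..v})"

definition Theta_u :: "real \<Rightarrow> real \<Rightarrow> (rbar \<times> rbar) set" where
  "Theta_u a b = off_diag \<inter>
     (if a = 0 then {}
      else if b \<ge> 1 then Iic (- 1) \<times> Ici (b - 1) \<union> Icc (- 1) 0 \<times> Ici (- 1 / a)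
      else Iic (- 1) \<times> Ici (b - 1)
         \<union> Icc (- 1) 0 \<times> Ici (min (- b / (b - 1)) (- 1 / a))
         \<union> Icc 0 1 \<times> Ici (- 1 / (b - 1)))"

definition Theta_l :: "real \<Rightarrow> real \<Rightarrow> (rbar \<times> rbar) set" where
  "Theta_l a b = off_diag \<inter>
     (if b = 0 then {}
      else if a \<le> - 1 then Icc 0 1 \<times> Iic (- 1 / b) \<union> Ici 1 \<times> Iic (a + 1)
      else Icc (- 1) 0 \<times> Iic (- 1 / (a + 1))
         \<union> Icc 0 1 \<times> Iic (max (a / (a + 1)) (- 1 / b))
         \<union> Ici 1 \<times> Iic (a + 1))"

definition Theta :: "real \<Rightarrow> real \<Rightarrow> (rbar \<times> rbar) set" where
  "Theta a b = Theta_u a b \<union> Theta_l a b"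

text \<open>The part of a region in the plane. The upper and lower parts of the region meet at the point
  \<open>(0, \<infinity>)\<close> (as \<open>\<infinity> = - \<infinity>\<close>), so it is in the plane that they are the connected components.\<close>

definition planar :: "(rbar \<times> rbar) set \<Rightarrow> (real \<times> real) set" where
  "planar S = {(x, y). (Some x, Some y) \<in> S}"

text \<open>On the two boundary curves \<open>a = 0\<close> and \<open>b = a + 1\<close>, \<open>0 < b < 1\<close> of the parameter set, the
  trapping property fails on some segments in horizontal lines: on \<open>stray a\<close> both the
  reaching property and the invariance fail, on \<open>seam a b\<close> only the invariance fails. Both sets
  are empty for all other parameters (\<open>stray_seam_empty\<close>), and no point of them can be kept
  (\<open>stray_never_trapped\<close>, \<open>seam_leaves_Theta\<close>).\<close>

definition stray :: "real \<Rightarrow> (rbar \<times> rbar) set" where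
  "stray a = (if a = 0 then Some ` {0<..<1} \<times> {Some 0} \<union> Some ` {..<0} \<times> {None} else {})"

definition seam :: "real \<Rightarrow> real \<Rightarrow> (rbar \<times> rbar) set" where
  "seam a b = (if b = a + 1 \<and> 0 < b \<and> b < 1 then Some ` {1..<2} \<times> {Some b} else {})"

lemma stray_seam_empty:
  assumes "a \<noteq> 0" and "b - a > 1 \<or> b = 0"
  shows "stray a = {}" and "seam a b = {}"
  using assms by (auto simp: stray_def seam_def)

lemma stray_never_trapped:
  assumes ab: "(a, b) \<in> params" and p: "p \<in> stray a" and "N > 0"
  shows "p \<in> off_diag" and "(F a b ^^ N) p \<notin> Theta a b"
proof -
  have a: "a = 0" and b: "b \<ge> 1"
    using p ab by (auto simp: stray_def params_def split: if_splits)
  show "p \<in> off_diag"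
    using p by (auto simp: stray_def off_diag_def split: if_splits)
  have out: "(Some t, None) \<notin> Theta a b" if "t < - 1" for t
    using that a b
    by (auto simp: Theta_def Theta_u_def Theta_l_def Icc_def Ici_def Iic_def)
  have step: "\<exists>t < - 1. F a b p = (Some t, None)"
  proof -
    consider x where "0 < x" "x < 1" "p = (Some x, Some 0)"
      | x where "x < 0" "p = (Some x, None)"
      using p a by (auto simp: stray_def)
    then show ?thesis
    proof cases
      case 1
      then have "F a b p = (Some (- 1 / x), None)" and "- 1 / x < - 1"
        using a b by (simp_all add: F_def below_def field_simps)
      then show ?thesis by blast
    next
      case 2
      then have "F a b p = (Some (x - 1), None)"
        by (simp add: F_def below_def translate_def)
      then show ?thesis using 2 by auto
    qed
  qed
  have "\<exists>t < - 1. (F a b ^^ Suc n) p = (Some t, None)" for n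
  proof (induction n)
    case 0
    then show ?case using step by simp
  next
    case (Suc n)
    then obtain t where "t < - 1" "(F a b ^^ Suc n) p = (Some t, None)" by blast
    then have "(F a b ^^ Suc (Suc n)) p = (Some (t - 1), None)"
      by (simp add: F_def below_def translate_def)
    then show ?case using \<open>t < - 1\<close> by (intro exI[of _ "t - 1"]) auto
  qed
  then show "(F a b ^^ N) p \<notin> Theta a b"
    using out \<open>N > 0\<close> by (metis gr0_conv_Suc)
qed

lemma seam_leaves_Theta:
  assumes p: "p \<in> seam a b"
  shows "p \<in> Theta a b" and "F a b p \<notin> Theta a b"
proof -
  obtain x where x: "1 \<le> x" "x < 2" "p = (Some x, Some b)" and b: "b = a + 1" "0 < b" "b < 1"
    using p by (auto simp: seam_def split: if_splits)
  have a: "- 1 < a" "a < 0" using b by auto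
  show "p \<in> Theta a b"
    using x b a by (auto simp: Theta_def Theta_l_def off_diag_def Ici_def Iic_def)
  have Fp: "F a b p = (Some (x - 1), Some a)"
    using x b by (simp add: F_def below_def translate_def)
  have "0 < a * a" "0 < 1 + a" using a by (simp_all add: mult_neg_neg)
  then have 1: "a / (a + 1) < a" and 2: "- 1 / (a + 1) < a"
    using a by (simp_all add: divide_simps algebra_simps)
  have 3: "- b / (b - 1) > 0" "- 1 / a > 0" "- 1 / (b - 1) > 0"
    using a b by (auto simp: divide_simps)
  have "\<not> min (- b / (b - 1)) (- 1 / a) \<le> a" "\<not> - 1 / (b - 1) \<le> a"
    using 3 a by linarith+
  then have "(Some (x - 1), Some a) \<notin> Theta_u a b"
    using x a b(2,3) by (auto simp del: min_le_iff_disj simp: Theta_u_def Icc_def Ici_def Iic_def)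
  moreover have "\<not> a \<le> max (a / (a + 1)) (- 1 / b)" "\<not> a \<le> - 1 / (a + 1)"
    using 1 2 b by auto
  then have "(Some (x - 1), Some a) \<notin> Theta_l a b"
    using x a b(2,3) by (auto simp del: le_max_iff_disj simp: Theta_l_def Icc_def Ici_def Iic_def)
  ultimately show "F a b p \<notin> Theta a b"
    by (simp add: Fp Theta_def)
qed

end

theory Submission
  imports Defs
begin

text \<open>
  Each part of the region is a chain of rectangles, of which the diagonal removes at
  most corners. So the planar part is a union of convex sets, consecutive ones of which intersect
  (\<open>connected_planar_Theta_u\<close>, \<open>connected_planar_Theta_l\<close>), and the points at infinity are limits of
  planar ones (\<open>connectedin_from_planar\<close>). The upper part is above the diagonal and the lower one
  below it, hence they are the components.

  Invariance is a finite check (\<open>F_Theta_u_subset\<close>, \<open>F_Theta_l_subset\<close>): the shifts move the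
  rectangles over \<open>[-1, 0]\<close>, \<open>[0, 1]\<close> and the two half-lines into each other, and an inversion
  happens only over \<open>|x| \<ge> 1\<close>, up to boundary lines.

  As for the attraction, the shifts bring every finite \<open>y\<close> into \<open>[a, b)\<close>, where the map inverts; consider the
  orbit at these moments. If \<open>x\<close> and \<open>y\<close> do not have the same sign, then the inversion puts them on
  different sides of \<open>0\<close>, and when \<open>y\<close> has been shifted back to \<open>[a, b)\<close> the point \<open>x\<close> is far out
  and \<open>(x, y)\<close> is in the region (\<open>enters_if_not_same_sign\<close>). It remains to exclude that \<open>x\<close> and \<open>y\<close>
  have the same sign at all inversions. Translating \<open>x\<close> and \<open>y\<close> together until \<open>y\<close> is in \<open>[-1, 1]\<close>
  does not change the future of the orbit, by the relation \<open>(S T)\<^sup>3 = 1\<close> between the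
  inversion \<open>S\<close> and the shift \<open>T\<close> in the modular group
  (\<open>shift_to_unit_interval\<close>), and then also \<open>|x| < 1\<close> (\<open>enters_if_large\<close>). But from one such moment to
  the next, \<open>|x - y|\<close> is divided by \<open>|x y| < 1\<close>. This factor is bounded away from \<open>1\<close> infinitely often,
  because the orbit cannot stay near the parabolic points \<open>\<plusminus>1\<close> (\<open>parabolic_step\<close>). So \<open>|x - y|\<close>
  would grow beyond all bounds, while it is less than \<open>1\<close> for two numbers of the same sign in
  \<open>[-1, 1]\<close> (\<open>enters_if_same_sign\<close>).
\<close>

section \<open>Connectedness of the two parts\<close>

lemma mem_Icc [simp]: "None \<notin> Icc u v" "Some t \<in> Icc u v \<longleftrightarrow> u \<le> t \<and> t \<le> v"
  by (auto simp: Icc_def)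

lemma mem_Ici [simp]: "None \<in> Ici u" "Some t \<in> Ici u \<longleftrightarrow> u \<le> t"
  by (auto simp: Ici_def)

lemma mem_Iic [simp]: "None \<in> Iic v" "Some t \<in> Iic v \<longleftrightarrow> t \<le> v"
  by (auto simp: Iic_def)

lemma mem_off_diag [simp]: "(x, y) \<in> off_diag \<longleftrightarrow> x \<noteq> y"
  by (simp add: off_diag_def)

lemma Theta_subset_off_diag: "Theta a b \<subseteq> off_diag"
  by (auto simp: Theta_def Theta_u_def Theta_l_def)

lemma in_planar [simp]: "(x, y) \<in> planar S \<longleftrightarrow> (Some x, Some y) \<in> S"
  by (simp add: planar_def)

text \<open>A neighbourhood of \<open>\<infinity>\<close> misses only a compact set of reals, and an unbounded set is not
  contained in a compact one.\<close>

lemma infinity_in_closure_of_unbounded: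
  assumes "\<not> bounded A"
  shows "None \<in> Alexandroff_compactification euclideanreal closure_of (Some ` A)"
proof -
  have "\<exists>y \<in> Some ` A. y \<in> V"
    if V: "None \<in> V" "openin (Alexandroff_compactification euclideanreal) V" for V
  proof -
    obtain C where C: "compact C" "V = insert None (Some ` (- C))"
      using V by (auto simp: openin_Alexandroff_compactification Compl_eq_Diff_UNIV)
    then have "\<not> A \<subseteq> C"
      using assms bounded_subset compact_imp_bounded by blast
    then show ?thesis
      using C by auto
  qed
  then show ?thesis
    by (auto simp: in_closure_of)
qed

text \<open>A point of \<open>S\<close> with a coordinate \<open>\<infinity>\<close> is the limit, along its row or column, of finite points
  of \<open>S\<close>. So \<open>S\<close> lies between the image of its planar part and the closure of that image, and
  connectedness passes to such sets.\<close>

lemma connectedin_from_planar: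
  assumes conn: "connected (planar S)"
    and rows: "\<And>y. (None, Some y) \<in> S \<Longrightarrow> \<not> bounded {x. (Some x, Some y) \<in> S}"
    and cols: "\<And>x. (Some x, None) \<in> S \<Longrightarrow> \<not> bounded {y. (Some x, Some y) \<in> S}"
    and off: "S \<subseteq> off_diag"
  shows "connectedin rbar2_top S"
proof -
  let ?A = "Alexandroff_compactification euclideanreal"
  let ?e = "\<lambda>p. (Some (fst p), Some (snd p)) :: rbar \<times> rbar"
  let ?P = "?e ` planar S"
  have PS: "?P \<subseteq> S"
    by (auto simp: planar_def)
  have "continuous_map euclidean rbar2_top ?e"
    unfolding rbar2_top_def prod_topology_euclidean [symmetric]
    by (intro continuous_map_pairedI continuous_map_compose [unfolded comp_def, OF _ continuous_map_Some]
        continuous_map_fst continuous_map_snd)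
  then have conn_P: "connectedin rbar2_top ?P"
    by (rule connectedin_continuous_map_image) (simp add: conn)
  have closure: "rbar2_top closure_of (X \<times> Y) = (?A closure_of X) \<times> (?A closure_of Y)" for X Y
    by (simp add: rbar2_top_def closure_of_Times)
  have point: "Some t \<in> ?A closure_of {Some t}" for t :: real
    using closure_of_subset[of "{Some t}" ?A] by auto
  have "p \<in> rbar2_top closure_of ?P" if p: "p \<in> S" for p
  proof -
    \<comment> \<open>The point \<open>(\<infinity>, \<infinity>)\<close>, which is on no finite row or column, is on the diagonal.\<close>
    have "fst p \<noteq> snd p"
      using p off by (auto simp: off_diag_def)
    then consider x y where "p = (Some x, Some y)" | x where "p = (Some x, None)"
      | y where "p = (None, Some y)"
      by (metis not_None_eq prod.collapse)
    then show ?thesis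
    proof cases
      case 1
      then have "p \<in> ?P" using p by (force simp: planar_def)
      moreover have "?P \<subseteq> topspace rbar2_top"
        using conn_P connectedin_subset_topspace by blast
      ultimately show ?thesis using closure_of_subset by blast
    next
      case (2 x)
      let ?L = "{Some x} \<times> Some ` {y. (Some x, Some y) \<in> S}"
      have "p \<in> rbar2_top closure_of ?L"
        using cols[of x] p 2 by (simp add: closure point infinity_in_closure_of_unbounded)
      moreover have "?L \<subseteq> ?P" by (force simp: planar_def)
      ultimately show ?thesis using closure_of_mono by blast
    next
      case (3 y)
      let ?L = "Some ` {x. (Some x, Some y) \<in> S} \<times> {Some y}"
      have "p \<in> rbar2_top closure_of ?L"
        using rows[of y] p 3 by (simp add: closure point infinity_in_closure_of_unbounded)
      moreover have "?L \<subseteq> ?P" by (force simp: planar_def)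
      ultimately show ?thesis using closure_of_mono by blast
    qed
  qed
  then show ?thesis
    using connectedin_intermediate_closure_of[OF conn_P PS] by blast
qed

text \<open>The closed rectangles of the region may touch the diagonal in a corner. Intersecting them
  with an open half-plane removes exactly this corner and keeps them convex.\<close>

definition above_diag :: "real set \<Rightarrow> real set \<Rightarrow> (real \<times> real) set" where
  "above_diag X Y = {(x, y). x \<in> X \<and> y \<in> Y \<and> x < y}"

definition below_diag :: "real set \<Rightarrow> real set \<Rightarrow> (real \<times> real) set" where
  "below_diag X Y = {(x, y). x \<in> X \<and> y \<in> Y \<and> y < x}"

lemma connected_above_diag:
  assumes "convex X" "convex Y"
  shows "connected (above_diag X Y)"
proof -
  have "above_diag X Y = X \<times> Y \<inter> {p. (1, - 1) \<bullet> p < 0}"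
    by (auto simp: above_diag_def inner_prod_def)
  then show ?thesis
    using assms by (simp add: convex_connected convex_Int convex_Times convex_halfspace_lt)
qed

lemma connected_below_diag:
  assumes "convex X" "convex Y"
  shows "connected (below_diag X Y)"
proof -
  have "below_diag X Y = X \<times> Y \<inter> {p. (- 1, 1) \<bullet> p < 0}"
    by (auto simp: below_diag_def inner_prod_def)
  then show ?thesis
    using assms by (simp add: convex_connected convex_Int convex_Times convex_halfspace_lt)
qed

text \<open>Two adjacent columns share a vertical line, and above the diagonal both contain its points that
  are high enough.\<close>

lemma connected_above_diag_Un:
  assumes "convex X" "convex X'" "t \<in> X \<inter> X'"
  shows "connected (above_diag X {c..} \<union> above_diag X' {c'..})"
proof -
  have "(t, max (max c c') (t + 1)) \<in> above_diag X {c..} \<inter> above_diag X' {c'..}"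
    using assms by (auto simp: above_diag_def)
  then show ?thesis
    using assms by (intro connected_Un connected_above_diag) auto
qed

lemma connected_below_diag_Un:
  assumes "convex X" "convex X'" "t \<in> X \<inter> X'"
  shows "connected (below_diag X {..c} \<union> below_diag X' {..c'})"
proof -
  have "(t, min (min c c') (t - 1)) \<in> below_diag X {..c} \<inter> below_diag X' {..c'}"
    using assms by (auto simp: below_diag_def)
  then show ?thesis
    using assms by (intro connected_Un connected_below_diag) auto
qed

lemma planar_Un: "planar (S \<union> T) = planar S \<union> planar T"
  by (auto simp: planar_def)

lemma planar_rectangle_above:
  assumes "u \<le> v"
  shows "planar (off_diag \<inter> Iic u \<times> Ici v) = above_diag {..u} {v..}"
    and "planar (off_diag \<inter> Icc t u \<times> Ici v) = above_diag {t..u} {v..}"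
  using assms by (auto simp: planar_def above_diag_def)

lemma planar_rectangle_below:
  assumes "v \<le> u"
  shows "planar (off_diag \<inter> Ici u \<times> Iic v) = below_diag {u..} {..v}"
    and "planar (off_diag \<inter> Icc u t \<times> Iic v) = below_diag {u..t} {..v}"
  using assms by (auto simp: planar_def below_diag_def)

lemma planar_Theta_u_eq:
  assumes "(a, b) \<in> params"
  shows "planar (Theta_u a b) =
    (if a = 0 then {}
     else if b \<ge> 1 then above_diag {..- 1} {b - 1..} \<union> above_diag {- 1..0} {- 1 / a..}
     else above_diag {..- 1} {b - 1..}
         \<union> above_diag {- 1..0} {min (- b / (b - 1)) (- 1 / a)..}
         \<union> above_diag {0..1} {- 1 / (b - 1)..})"
proof -
  have ab: "a \<le> 0" "0 \<le> b" "b - a \<ge> 1"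
    using assms by (auto simp: params_def)
  have 1: "0 \<le> - 1 / a" if "a \<noteq> 0"
    using that ab by (simp add: divide_simps)
  have 2: "0 \<le> - b / (b - 1)" "1 \<le> - 1 / (b - 1)" if "b < 1"
    using that ab by (auto simp: divide_simps)
  have 3: "0 \<le> min (- b / (b - 1)) (- 1 / a)" if "b < 1" "a \<noteq> 0"
    using 1 2 that by (meson min.boundedI)
  have 4: "- 1 \<le> b - 1" using ab by simp
  show ?thesis
    unfolding Theta_u_def
    by (auto simp only: Int_Un_distrib planar_Un planar_rectangle_above[OF 1]
        planar_rectangle_above[OF 2(2)] planar_rectangle_above[OF 3] planar_rectangle_above[OF 4]
        not_le split: if_splits) (simp_all add: planar_def)
qed

lemma planar_Theta_l_eq:
  assumes "(a, b) \<in> params"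
  shows "planar (Theta_l a b) =
    (if b = 0 then {}
     else if a \<le> - 1 then below_diag {0..1} {..- 1 / b} \<union> below_diag {1..} {..a + 1}
     else below_diag {- 1..0} {..- 1 / (a + 1)}
         \<union> below_diag {0..1} {..max (a / (a + 1)) (- 1 / b)}
         \<union> below_diag {1..} {..a + 1})"
proof -
  have ab: "a \<le> 0" "0 \<le> b" "b - a \<ge> 1"
    using assms by (auto simp: params_def)
  have 1: "- 1 / b \<le> 0" if "b \<noteq> 0"
    using that ab by (simp add: divide_simps)
  have 2: "a / (a + 1) \<le> 0" "- 1 / (a + 1) \<le> - 1" if "- 1 < a"
    using that ab by (auto simp: divide_simps)
  have 3: "max (a / (a + 1)) (- 1 / b) \<le> 0" if "- 1 < a" "b \<noteq> 0"
    using 1 2 that by (meson max.boundedI)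
  have 4: "a + 1 \<le> 1" using ab by simp
  show ?thesis
    unfolding Theta_l_def
    by (auto simp only: Int_Un_distrib planar_Un planar_rectangle_below[OF 1]
        planar_rectangle_below[OF 2(2)] planar_rectangle_below[OF 3] planar_rectangle_below[OF 4]
        not_le split: if_splits) (simp_all add: planar_def)
qed

lemma connected_above_diag_Un3:
  assumes "convex X" "convex X'" "convex X''" "s \<in> X \<inter> X'" "t \<in> X' \<inter> X''"
  shows "connected (above_diag X {c..} \<union> above_diag X' {c'..} \<union> above_diag X'' {c''..})"
proof -
  have "(t, max (max c' c'') (t + 1)) \<in> above_diag X' {c'..} \<inter> above_diag X'' {c''..}"
    using assms by (auto simp: above_diag_def)
  then show ?thesis
    using assms by (intro connected_Un connected_above_diag_Un connected_above_diag) auto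
qed

lemma connected_below_diag_Un3:
  assumes "convex X" "convex X'" "convex X''" "s \<in> X \<inter> X'" "t \<in> X' \<inter> X''"
  shows "connected (below_diag X {..c} \<union> below_diag X' {..c'} \<union> below_diag X'' {..c''})"
proof -
  have "(t, min (min c' c'') (t - 1)) \<in> below_diag X' {..c'} \<inter> below_diag X'' {..c''}"
    using assms by (auto simp: below_diag_def)
  then show ?thesis
    using assms by (intro connected_Un connected_below_diag_Un connected_below_diag) auto
qed

lemma connected_planar_Theta_u:
  assumes "(a, b) \<in> params"
  shows "connected (planar (Theta_u a b))"
proof -
  have "connected (above_diag {..- 1} {d..} \<union> above_diag {- 1..0} {c..})" for c d
    by (rule connected_above_diag_Un[where t = "- 1"]) auto
  moreover have "connected (above_diag {..- 1} {c..} \<union> above_diag {- 1..0} {d..}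
      \<union> above_diag {0..1} {e..})" for c d e
    by (rule connected_above_diag_Un3[where s = "- 1" and t = 0]) auto
  ultimately show ?thesis
    unfolding planar_Theta_u_eq[OF assms] by simp
qed

lemma connected_planar_Theta_l:
  assumes "(a, b) \<in> params"
  shows "connected (planar (Theta_l a b))"
proof -
  have "connected (below_diag {0..1} {..c} \<union> below_diag {1..} {..d})" for c d
    by (rule connected_below_diag_Un[where t = 1]) auto
  moreover have "connected (below_diag {- 1..0} {..c} \<union> below_diag {0..1} {..d}
      \<union> below_diag {1..} {..e})" for c d e
    by (rule connected_below_diag_Un3[where s = 0 and t = 1]) auto
  ultimately show ?thesis
    unfolding planar_Theta_l_eq[OF assms] by simp
qed

lemma not_bounded_if_ray:
  fixes A :: "real set"
  assumes "{m..} \<subseteq> A \<or> {..m} \<subseteq> A"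
  shows "\<not> bounded A"
proof
  assume "bounded A"
  then obtain B where B: "\<And>x. x \<in> A \<Longrightarrow> \<bar>x\<bar> \<le> B"
    by (auto simp: bounded_iff)
  have "m + \<bar>m\<bar> + \<bar>B\<bar> + 1 \<in> {m..}" "m - \<bar>m\<bar> - \<bar>B\<bar> - 1 \<in> {..m}"
    by auto
  then have "m + \<bar>m\<bar> + \<bar>B\<bar> + 1 \<in> A \<or> m - \<bar>m\<bar> - \<bar>B\<bar> - 1 \<in> A"
    using assms by blast
  then show False
    using B by fastforce
qed

lemma connectedin_Theta_u:
  assumes "(a, b) \<in> params"
  shows "connectedin rbar2_top (Theta_u a b)"
proof (rule connectedin_from_planar[OF connected_planar_Theta_u[OF assms]])
  show "\<not> bounded {x. (Some x, Some y) \<in> Theta_u a b}" if "(None, Some y) \<in> Theta_u a b" for y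
    using that
    by (intro not_bounded_if_ray[of "min (- 1) (y - 1)"])
      (auto simp: Theta_u_def split: if_splits)
  show "\<not> bounded {y. (Some x, Some y) \<in> Theta_u a b}" if x: "(Some x, None) \<in> Theta_u a b" for x
  proof -
    obtain c c' d where eq: "Theta_u a b = off_diag \<inter>
       (if a = 0 then {}
        else if b \<ge> 1 then Iic (- 1) \<times> Ici (b - 1) \<union> Icc (- 1) 0 \<times> Ici c
        else Iic (- 1) \<times> Ici (b - 1) \<union> Icc (- 1) 0 \<times> Ici c' \<union> Icc 0 1 \<times> Ici d)"
      unfolding Theta_u_def by blast
    obtain m where m: "x < m" "b - 1 \<le> m" "c \<le> m" "c' \<le> m" "d \<le> m"
      using that[of "max (max (x + 1) (b - 1)) (max c (max c' d))"] by linarith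
    have "(Some x, Some y) \<in> Theta_u a b" if "m \<le> y" for y
    proof -
      have "Some y \<in> Ici (b - 1)" "Some y \<in> Ici c" "Some y \<in> Ici c'" "Some y \<in> Ici d" "x \<noteq> y"
        using m that by auto
      then show ?thesis
        using x unfolding eq
        by (auto simp del: mem_Icc mem_Ici mem_Iic split: if_splits)
    qed
    then show ?thesis
      by (intro not_bounded_if_ray[of m]) auto
  qed
qed (auto simp: Theta_u_def)

lemma connectedin_Theta_l:
  assumes "(a, b) \<in> params"
  shows "connectedin rbar2_top (Theta_l a b)"
proof (rule connectedin_from_planar[OF connected_planar_Theta_l[OF assms]])
  show "\<not> bounded {x. (Some x, Some y) \<in> Theta_l a b}" if "(None, Some y) \<in> Theta_l a b" for y
    using that
    by (intro not_bounded_if_ray[of "max 1 (y + 1)"])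
      (auto simp: Theta_l_def split: if_splits)
  show "\<not> bounded {y. (Some x, Some y) \<in> Theta_l a b}" if x: "(Some x, None) \<in> Theta_l a b" for x
  proof -
    obtain c c' d where eq: "Theta_l a b = off_diag \<inter>
       (if b = 0 then {}
        else if a \<le> - 1 then Icc 0 1 \<times> Iic c \<union> Ici 1 \<times> Iic (a + 1)
        else Icc (- 1) 0 \<times> Iic d \<union> Icc 0 1 \<times> Iic c' \<union> Ici 1 \<times> Iic (a + 1))"
      unfolding Theta_l_def by blast
    obtain m where m: "m < x" "m \<le> a + 1" "m \<le> c" "m \<le> c'" "m \<le> d"
      using that[of "min (min (x - 1) (a + 1)) (min c (min c' d))"] by linarith
    have "(Some x, Some y) \<in> Theta_l a b" if "y \<le> m" for y
    proof -
      have "Some y \<in> Iic (a + 1)" "Some y \<in> Iic c" "Some y \<in> Iic c'" "Some y \<in> Iic d" "x \<noteq> y"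
        using m that by auto
      then show ?thesis
        using x unfolding eq
        by (auto simp del: mem_Icc mem_Ici mem_Iic split: if_splits)
    qed
    then show ?thesis
      by (intro not_bounded_if_ray[of m]) auto
  qed
qed (auto simp: Theta_l_def)

text \<open>A connected subset of \<open>U \<union> L\<close> cannot meet both of the disjoint open sets, so it lies in \<open>U\<close> or
  in \<open>L\<close>.\<close>

lemma components_Un_separated:
  fixes U L :: "'a::topological_space set"
  assumes "connected U" "connected L" "open P" "open Q" "U \<subseteq> P" "L \<subseteq> Q" "P \<inter> Q = {}"
  shows "components (U \<union> L) = {U, L} - {{}}"
proof -
  have split: "C \<subseteq> U \<or> C \<subseteq> L" if "connected C" "C \<subseteq> U \<union> L" for C
  proof -
    have "P \<inter> C = {} \<or> Q \<inter> C = {}"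
      using connectedD[OF that(1) assms(3,4)] that assms by blast
    then show ?thesis
      using that assms by blast
  qed
  show ?thesis
  proof (intro equalityI subsetI)
    fix C assume C: "C \<in> components (U \<union> L)"
    then have "C \<noteq> {}" "C \<subseteq> U \<or> C \<subseteq> L"
      using split by (auto simp: in_components_maximal)
    then have "C = U \<or> C = L"
      using C assms(1,2) unfolding in_components_maximal
      by (metis le_sup_iff subset_empty sup.cobounded1 sup.cobounded2)
    then show "C \<in> {U, L} - {{}}" using \<open>C \<noteq> {}\<close> by blast
  next
    fix C assume C: "C \<in> {U, L} - {{}}"
    then have "connected C" "C \<noteq> {}" "C \<subseteq> U \<union> L"
      using assms by auto
    moreover have "D = C" if "C \<subseteq> D" "D \<subseteq> U \<union> L" "connected D" for D
      using split[OF that(3,2)] that C assms by blast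
    ultimately show "C \<in> components (U \<union> L)"
      unfolding in_components_maximal by blast
  qed
qed

lemma components_planar_Theta:
  assumes ab: "(a, b) \<in> params"
  shows "components (planar (Theta a b)) = {planar (Theta_u a b), planar (Theta_l a b)} - {{}}"
    and "card (components (planar (Theta a b))) = (if a = 0 \<or> b = 0 then 1 else 2)"
proof -
  let ?P = "{p :: real \<times> real. fst p < snd p}" and ?Q = "{p :: real \<times> real. snd p < fst p}"
  have "open ?P" "open ?Q"
    by (intro open_Collect_less continuous_intros)+
  moreover have sub: "planar (Theta_u a b) \<subseteq> ?P" "planar (Theta_l a b) \<subseteq> ?Q"
    unfolding planar_Theta_u_eq[OF ab] planar_Theta_l_eq[OF ab]
    by (auto simp: above_diag_def below_diag_def split: if_splits)
  moreover have "planar (Theta a b) = planar (Theta_u a b) \<union> planar (Theta_l a b)"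
    by (auto simp: planar_def Theta_def)
  moreover have "?P \<inter> ?Q = {}" by auto
  ultimately show comp: "components (planar (Theta a b))
      = {planar (Theta_u a b), planar (Theta_l a b)} - {{}}"
    using components_Un_separated[OF connected_planar_Theta_u[OF ab] connected_planar_Theta_l[OF ab]]
    by metis
  have "(- 1, max b 0) \<in> planar (Theta_u a b)" if "a \<noteq> 0"
    using that by (auto simp: Theta_u_def)
  moreover have "planar (Theta_u a b) = {}" if "a = 0"
    using planar_Theta_u_eq[OF ab] that by simp
  ultimately have U: "planar (Theta_u a b) = {} \<longleftrightarrow> a = 0" by blast
  have "(1, min a 0) \<in> planar (Theta_l a b)" if "b \<noteq> 0"
    using that by (auto simp: Theta_l_def)
  moreover have "planar (Theta_l a b) = {}" if "b = 0"
    using planar_Theta_l_eq[OF ab] that by simp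
  ultimately have L: "planar (Theta_l a b) = {} \<longleftrightarrow> b = 0" by blast
  have "\<not> (a = 0 \<and> b = 0)" using ab by (auto simp: params_def)
  then show "card (components (planar (Theta a b))) = (if a = 0 \<or> b = 0 then 1 else 2)"
  proof (cases "a = 0 \<or> b = 0")
    case True
    then have "components (planar (Theta a b)) = {planar (Theta_u a b)}
        \<or> components (planar (Theta a b)) = {planar (Theta_l a b)}"
      using comp U L \<open>\<not> (a = 0 \<and> b = 0)\<close> by auto
    then show ?thesis using True by auto
  next
    case False
    then have "planar (Theta_u a b) \<noteq> planar (Theta_l a b)"
      using U sub by fastforce
    moreover have "components (planar (Theta a b)) = {planar (Theta_u a b), planar (Theta_l a b)}"
      using comp U L False by auto
    ultimately show ?thesis using False by simp
  qed
qed

section \<open>Invariance\<close>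

text \<open>The last two inequalities express \<open>-ab \<le> 1\<close> dynamically: inverting a negative point of
  \<open>[a, b)\<close> gives a point at or above \<open>b\<close>, and inverting a positive one gives a point below \<open>a\<close>.
  Hence an inversion is never followed immediately by another one.\<close>

lemma paramsD:
  assumes "(a, b) \<in> params"
  shows "a \<le> 0" "0 \<le> b" "a + 1 \<le> b" "- a * b \<le> 1" "a < b"
    and "a \<noteq> 0 \<Longrightarrow> b \<le> - 1 / a" and "b \<noteq> 0 \<Longrightarrow> - 1 / b \<le> a"
  using assms by (auto simp: params_def field_simps)

lemma translate_simps [simp]:
  "translate c None = None" "translate c (Some t) = Some (t + c)"
  "translate c (translate d x) = translate (d + c) x" "translate 0 x = x"
  "translate c x = translate c y \<longleftrightarrow> x = y"
  by (cases x; cases y; simp add: translate_def)+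

lemma neg_recip_neg_recip [simp]: "neg_recip (neg_recip x) = x"
  by (cases x rule: neg_recip.cases) auto

lemma neg_recip_eq_iff [simp]: "neg_recip x = neg_recip y \<longleftrightarrow> x = y"
  by (metis neg_recip_neg_recip)

lemma F_off_diag: "p \<in> off_diag \<Longrightarrow> F a b p \<in> off_diag"
  by (cases p) (auto simp: F_def)

lemma F_infinity: "F a b (x, None) = (translate (- 1) x, None)"
  by (simp add: F_def below_def)

lemma F_low: "t < a \<Longrightarrow> F a b (x, Some t) = (translate 1 x, Some (t + 1))"
  by (simp add: F_def below_def)

lemma F_middle:
  "a \<le> t \<Longrightarrow> t < b \<Longrightarrow> F a b (x, Some t) = (neg_recip x, neg_recip (Some t))"
  by (simp add: F_def below_def)

lemma F_high:
  "a \<le> b \<Longrightarrow> b \<le> t \<Longrightarrow> F a b (x, Some t) = (translate (- 1) x, Some (t - 1))"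
  by (simp add: F_def below_def)

text \<open>An interval that starts at the minimum of two numbers is the union of two intervals, and the
  rectangle over \<open>[-1, 0]\<close> with lower bound \<open>-1/a\<close> occurs for every \<open>b\<close>. Splitting the minimum
  thus turns the case distinction of the definition into one list of rectangles.\<close>

lemma mem_Theta_u_iff:
  "(x, y) \<in> Theta_u a b \<longleftrightarrow> x \<noteq> y \<and> a \<noteq> 0 \<and>
     (x \<in> Iic (- 1) \<and> y \<in> Ici (b - 1)
      \<or> x \<in> Icc (- 1) 0 \<and> y \<in> Ici (- 1 / a)
      \<or> b < 1 \<and> x \<in> Icc (- 1) 0 \<and> y \<in> Ici (- b / (b - 1))
      \<or> b < 1 \<and> x \<in> Icc 0 1 \<and> y \<in> Ici (- 1 / (b - 1)))"
proof -
  have "y \<in> Ici (min c d) \<longleftrightarrow> y \<in> Ici c \<or> y \<in> Ici d" for c d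
    by (cases y) auto
  then show ?thesis
    unfolding Theta_u_def by (auto simp only: mem_off_diag not_le split: if_splits)
qed

lemma mem_Theta_l_iff:
  "(x, y) \<in> Theta_l a b \<longleftrightarrow> x \<noteq> y \<and> b \<noteq> 0 \<and>
     (x \<in> Ici 1 \<and> y \<in> Iic (a + 1)
      \<or> x \<in> Icc 0 1 \<and> y \<in> Iic (- 1 / b)
      \<or> - 1 < a \<and> x \<in> Icc 0 1 \<and> y \<in> Iic (a / (a + 1))
      \<or> - 1 < a \<and> x \<in> Icc (- 1) 0 \<and> y \<in> Iic (- 1 / (a + 1)))"
proof -
  have "y \<in> Iic (max c d) \<longleftrightarrow> y \<in> Iic c \<or> y \<in> Iic d" for c d
    by (cases y) auto
  then show ?thesis
    unfolding Theta_l_def by (auto simp only: mem_off_diag not_le split: if_splits)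
qed

lemma translate_mem:
  "x \<in> Iic v \<Longrightarrow> translate c x \<in> Iic (v + c)"
  "x \<in> Ici u \<Longrightarrow> translate c x \<in> Ici (u + c)"
  "x \<in> Icc u v \<Longrightarrow> translate c x \<in> Icc (u + c) (v + c)"
  by (cases x; simp)+

lemma neg_recip_mem:
  "x \<in> Iic (- 1) \<Longrightarrow> neg_recip x \<in> Icc 0 1"
  "x \<in> Ici 1 \<Longrightarrow> neg_recip x \<in> Icc (- 1) 0"
  "x \<in> Icc (- 1) 0 \<Longrightarrow> neg_recip x \<in> Ici 1"
  "x \<in> Icc 0 1 \<Longrightarrow> neg_recip x \<in> Iic (- 1)"
  by (cases x rule: neg_recip.cases; auto simp: field_simps)+

lemma interval_mono:
  "x \<in> Iic v \<Longrightarrow> v \<le> v' \<Longrightarrow> x \<in> Iic v'"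
  "x \<in> Ici u \<Longrightarrow> u' \<le> u \<Longrightarrow> x \<in> Ici u'"
  "x \<in> Icc u v \<Longrightarrow> u' \<le> u \<Longrightarrow> x \<in> Ici u'"
  "x \<in> Icc u v \<Longrightarrow> v \<le> v' \<Longrightarrow> x \<in> Iic v'"
  by (cases x; simp)+

text \<open>Apart from the strip \<open>b - 1 \<le> y < b\<close> over \<open>x \<le> -1\<close>, the upper part lies in \<open>y \<ge> b\<close>. There the
  map is the left shift, which moves each column to the column on its left; the bounds on \<open>y\<close> are
  chosen to fit. Inverting the strip lands in the third upper rectangle for \<open>y < 0\<close>, and in the
  lower part for \<open>y \<ge> 0\<close>.\<close>

lemma F_Theta_u_subset:
  assumes ab: "(a, b) \<in> params" and p: "p \<in> Theta_u a b"
  shows "F a b p \<in> Theta a b"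
proof -
  note P = paramsD[OF ab]
  obtain x y where xy: "p = (x, y)" by (cases p)
  have "x \<noteq> y" "a < 0" using p P(1) xy by (auto simp: mem_Theta_u_iff)
  have off: "F a b p \<in> off_diag"
    using \<open>x \<noteq> y\<close> xy by (simp add: F_off_diag)
  have third: "- 1 / (b - 1) - 1 = - b / (b - 1)" if "b < 1"
    using that by (simp add: field_simps)
  have bounds: "b \<le> - 1 / a" "b < 1 \<Longrightarrow> b \<le> - b / (b - 1)" "b < 1 \<Longrightarrow> b \<le> - 1 / (b - 1)"
    using P \<open>a < 0\<close> zero_le_square[of b] by (auto simp: field_simps intro: order_trans[of b 1])
  consider (shift) "y \<in> Ici b" | (invert) t where "y = Some t" "b - 1 \<le> t" "t < b" "x \<in> Iic (- 1)"
  proof (cases y)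
    case None
    then show ?thesis using that(1) by simp
  next
    case (Some t)
    show ?thesis
    proof (cases "b \<le> t")
      case True
      then show ?thesis using that(1) Some by simp
    next
      case False
      then have "x \<in> Iic (- 1) \<and> b - 1 \<le> t"
        using p xy Some bounds by (auto simp: mem_Theta_u_iff)
      then show ?thesis using that(2) Some False by auto
    qed
  qed
  then show ?thesis
  proof cases
    case shift
    have Fp: "F a b p = (translate (- 1) x, translate (- 1) y)"
      using shift xy P(5) by (cases y) (auto simp: F_infinity F_high)
    have y': "translate (- 1) y \<in> Ici (b - 1)"
      using translate_mem(2)[OF shift, of "- 1"] by simp
    have "x \<in> Iic 0 \<or> b < 1 \<and> x \<in> Icc 0 1 \<and> y \<in> Ici (- 1 / (b - 1))"
      using p xy by (auto simp: mem_Theta_u_iff intro: interval_mono)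
    then show ?thesis
    proof
      assume "x \<in> Iic 0"
      then have "translate (- 1) x \<in> Iic (- 1)"
        using translate_mem(1)[of x 0 "- 1"] by simp
      then show ?thesis
        using y' off Fp \<open>a < 0\<close> by (simp add: Theta_def mem_Theta_u_iff)
    next
      assume A: "b < 1 \<and> x \<in> Icc 0 1 \<and> y \<in> Ici (- 1 / (b - 1))"
      then have "translate (- 1) x \<in> Icc (- 1) 0" "translate (- 1) y \<in> Ici (- b / (b - 1))"
        using translate_mem(3)[of x 0 1 "- 1"] translate_mem(2)[of y "- 1 / (b - 1)" "- 1"] third
        by simp_all
      then show ?thesis
        using A off Fp \<open>a < 0\<close> by (simp add: Theta_def mem_Theta_u_iff)
    qed
  next
    case (invert t)
    have Fp: "F a b p = (neg_recip x, neg_recip (Some t))"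
      using invert xy P by (simp add: F_middle)
    have x': "neg_recip x \<in> Icc 0 1"
      using invert neg_recip_mem by blast
    show ?thesis
    proof (cases "t < 0")
      case True
      then have "b < 1" using invert by simp
      moreover have "neg_recip (Some t) \<in> Ici (- 1 / (b - 1))"
        using True invert by (simp add: field_simps)
      ultimately show ?thesis
        using x' off Fp \<open>a < 0\<close> by (simp add: Theta_def mem_Theta_u_iff)
    next
      case False
      then have "0 < b" and "neg_recip (Some t) \<in> Iic (- 1 / b)"
        using invert by (auto simp: field_simps)
      then show ?thesis
        using x' off Fp by (simp add: Theta_def mem_Theta_l_iff)
    qed
  qed
qed

text \<open>Below \<open>a\<close> the columns are shifted to the right, as in the upper part. In the inverted strip
  \<open>a \<le> y < b\<close> there is \<open>x \<ge> 1\<close>, except that a rectangle over \<open>[0, 1]\<close> may reach up to the line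
  \<open>y = a\<close>. The half-open strip makes the lower part less symmetric than it looks: the points with
  \<open>y = \<infinity>\<close> are shifted to the left, and so are those on \<open>y = b\<close>, a line that meets the lower part
  only if \<open>b = a + 1\<close>. The latter gives the seam, and the former, together with the height \<open>0\<close>
  that is inverted to \<open>\<infinity>\<close>, the stray points.\<close>

lemma F_Theta_l_subset:
  assumes ab: "(a, b) \<in> params" and p: "p \<in> Theta_l a b"
    and nonstray: "p \<notin> stray a" and nonseam: "p \<notin> seam a b"
  shows "F a b p \<in> Theta a b"
proof -
  note P = paramsD[OF ab]
  obtain x y where xy: "p = (x, y)" by (cases p)
  have "x \<noteq> y" "0 < b" using p P(2) xy by (auto simp: mem_Theta_l_iff)
  have off: "F a b p \<in> off_diag"
    using \<open>x \<noteq> y\<close> xy by (simp add: F_off_diag)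
  have upper: "F a b p = (x', y') \<Longrightarrow> a \<noteq> 0 \<Longrightarrow> x' \<in> Iic (- 1) \<Longrightarrow> y' \<in> Ici (b - 1) \<Longrightarrow> ?thesis"
    for x' y'
    using off by (simp add: Theta_def mem_Theta_u_iff)
  have upper2: "F a b p = (x', y') \<Longrightarrow> a \<noteq> 0 \<Longrightarrow> x' \<in> Icc (- 1) 0 \<Longrightarrow> y' \<in> Ici (- 1 / a) \<Longrightarrow> ?thesis"
    for x' y'
    using off by (simp add: Theta_def mem_Theta_u_iff)
  have lower: "F a b p = (x', y') \<Longrightarrow> x' \<in> Ici 1 \<Longrightarrow> y' \<in> Iic (a + 1) \<Longrightarrow> ?thesis" for x' y'
    using off \<open>0 < b\<close> by (simp add: Theta_def mem_Theta_l_iff)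
  have lower2: "F a b p = (x', y') \<Longrightarrow> - 1 < a \<Longrightarrow> x' \<in> Icc 0 1 \<Longrightarrow> y' \<in> Iic (a / (a + 1)) \<Longrightarrow> ?thesis"
    for x' y'
    using off \<open>0 < b\<close> by (simp add: Theta_def mem_Theta_l_iff)
  have lower3: "F a b p = (x', y') \<Longrightarrow> - 1 < a \<Longrightarrow> x' \<in> Icc (- 1) 0 \<Longrightarrow> y' \<in> Iic (- 1 / (a + 1)) \<Longrightarrow> ?thesis"
    for x' y'
    using off \<open>0 < b\<close> by (simp add: Theta_def mem_Theta_l_iff)
  have bounds: "- 1 / b \<le> a" "- 1 < a \<Longrightarrow> a / (a + 1) \<le> a" "- 1 < a \<Longrightarrow> - 1 / (a + 1) \<le> - 1"
    using P \<open>0 < b\<close> by (auto simp: field_simps)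
  consider (inf) "y = None" | (low) t where "y = Some t" "t < a"
    | (mid) t where "y = Some t" "a \<le> t" "t < b" | (high) t where "y = Some t" "b \<le> t"
    by (cases y) force+
  then show ?thesis
  proof cases
    case inf
    then obtain s where s: "x = Some s" using \<open>x \<noteq> y\<close> by auto
    have Fp: "F a b p = (Some (s - 1), None)"
      by (simp add: xy inf s F_infinity)
    \<comment> \<open>For \<open>a = 0\<close> the points with \<open>s < 0\<close> are stray.\<close>
    have "0 \<le> s \<or> a \<noteq> 0 \<and> - 1 \<le> s"
      using p nonstray by (auto simp: xy inf s mem_Theta_l_iff stray_def split: if_splits)
    then consider "1 \<le> s" | "0 \<le> s" "s \<le> 1" "a = 0" | "- 1 \<le> s" "s \<le> 1" "a \<noteq> 0"
      by linarith
    then show ?thesis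
    proof cases
      case 1
      then have "s \<le> 2 \<or> 2 < s" by linarith
      then show ?thesis
        using 1 off \<open>0 < b\<close> by (auto simp: Fp Theta_def mem_Theta_l_iff)
    next
      case 2
      then show ?thesis by (intro lower3[OF Fp]) auto
    next
      case 3
      then have "s \<le> 0 \<or> 0 < s" by linarith
      then show ?thesis
        using 3 off by (auto simp: Fp Theta_def mem_Theta_u_iff)
    qed
  next
    case (low t)
    have Fp: "F a b p = (translate 1 x, Some (t + 1))"
      using low xy by (simp add: F_low)
    have "x \<in> Ici 0 \<or> - 1 < a \<and> x \<in> Icc (- 1) 0 \<and> t \<le> - 1 / (a + 1)"
      using p by (auto simp: xy low mem_Theta_l_iff intro: interval_mono)
    then show ?thesis
    proof
      assume "x \<in> Ici 0"
      then show ?thesis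
        using low translate_mem(2)[of x 0 1] by (intro lower[OF Fp]) auto
    next
      assume A: "- 1 < a \<and> x \<in> Icc (- 1) 0 \<and> t \<le> - 1 / (a + 1)"
      have "- 1 / (a + 1) + 1 = a / (a + 1)" using A by (simp add: field_simps)
      then have "t + 1 \<le> a / (a + 1)" using A by linarith
      then show ?thesis
        using A translate_mem(3)[of x "- 1" 0 1] by (intro lower2[OF Fp]) auto
    qed
  next
    case (mid t)
    have Fp: "F a b p = (neg_recip x, neg_recip (Some t))"
      using mid xy P by (simp add: F_middle)
    have "x \<in> Ici 1 \<and> t \<le> a + 1 \<or> x \<in> Icc 0 1 \<and> t = a"
    proof -
      have "x \<in> Ici 1 \<and> t \<le> a + 1 \<or> x \<in> Icc 0 1 \<and> t \<le> - 1 / b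
          \<or> - 1 < a \<and> x \<in> Icc 0 1 \<and> t \<le> a / (a + 1) \<or> - 1 < a \<and> t \<le> - 1 / (a + 1)"
        using p unfolding xy mid(1) mem_Theta_l_iff mem_Iic by blast
      then show ?thesis
        using mid(2) bounds P(1) by linarith
    qed
    then show ?thesis
    proof
      assume A: "x \<in> Ici 1 \<and> t \<le> a + 1"
      then have x': "neg_recip x \<in> Icc (- 1) 0" using neg_recip_mem by blast
      consider "a < 0" "t \<le> 0" | "a = 0" "t = 0" | "0 < t"
        using mid P(1) by linarith
      then show ?thesis
      proof cases
        case 1
        then show ?thesis
          using x' mid by (intro upper2[OF Fp]) (auto simp: field_simps)
      next
        case 2
        then show ?thesis
          using x' by (intro lower3[OF Fp]) auto
      next
        case 3
        then show ?thesis
          using x' A by (intro lower3[OF Fp]) (auto simp: field_simps)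
      qed
    next
      assume A: "x \<in> Icc 0 1 \<and> t = a"
      then have x': "neg_recip x \<in> Iic (- 1)" using neg_recip_mem by blast
      show ?thesis
      proof (cases "a = 0")
        case True
        then have "x = Some 1"
          using A nonstray \<open>x \<noteq> y\<close> mid(1) xy by (cases x) (auto simp: stray_def)
        then show ?thesis
          using True A by (intro lower3[OF Fp]) auto
      next
        case False
        then show ?thesis
          using x' A P by (intro upper[OF Fp]) auto
      qed
    qed
  next
    case (high t)
    have Fp: "F a b p = (translate (- 1) x, Some (t - 1))"
      using high xy P by (simp add: F_high)
    have "x \<in> Ici 1 \<and> t \<le> a + 1 \<or> t \<le> - 1 / b
        \<or> - 1 < a \<and> t \<le> a / (a + 1) \<or> - 1 < a \<and> t \<le> - 1 / (a + 1)"
      using p unfolding xy high(1) mem_Theta_l_iff mem_Iic by blast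
    then have t: "x \<in> Ici 1" "t = b" "b = a + 1"
      using high(2) bounds P by linarith+
    show ?thesis
    proof (cases "x \<in> Ici 2")
      case True
      then show ?thesis
        using translate_mem(2)[of x 2 "- 1"] t by (intro lower[OF Fp]) auto
    next
      case False
      then obtain s where s: "x = Some s" "1 \<le> s" "s < 2"
        using t by (cases x) auto
      then have "b = 1"
        using nonseam t P \<open>0 < b\<close> xy high by (auto simp: seam_def split: if_splits)
      then show ?thesis
        using s t by (intro lower2[OF Fp]) auto
    qed
  qed
qed

lemma F_Theta_subset:
  assumes "(a, b) \<in> params"
  shows "F a b ` (Theta a b - stray a - seam a b) \<subseteq> Theta a b"
proof (rule image_subsetI)
  fix p assume p: "p \<in> Theta a b - stray a - seam a b"
  then have "p \<in> Theta_u a b \<or> p \<in> Theta_l a b" by (simp add: Theta_def)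
  then show "F a b p \<in> Theta a b"
    using F_Theta_u_subset[OF assms] F_Theta_l_subset[OF assms] p by blast
qed

section \<open>Attraction\<close>

text \<open>Since at least one step is required, this depends only on the image of \<open>p\<close>, and points with
  the same image share it, whether they lie in the region or not.\<close>

definition enters :: "real \<Rightarrow> real \<Rightarrow> rbar \<times> rbar \<Rightarrow> bool" where
  "enters a b p \<longleftrightarrow> (\<exists>N>0. (F a b ^^ N) p \<in> Theta a b)"

lemma enters_via:
  assumes "0 < n" "(F a b ^^ n) p = q" "q \<in> Theta a b \<or> enters a b q"
  shows "enters a b p"
proof (cases "q \<in> Theta a b")
  case True
  then show ?thesis using assms by (auto simp: enters_def)
next
  case False
  then obtain m where "0 < m" "(F a b ^^ m) q \<in> Theta a b"
    using assms by (auto simp: enters_def)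
  then have "(F a b ^^ (m + n)) p \<in> Theta a b" "0 < m + n"
    using assms by (auto simp: funpow_add)
  then show ?thesis by (auto simp: enters_def)
qed

text \<open>Two orbits that meet have the same future; \<open>p\<close> and \<open>q\<close> need not be on a common orbit.\<close>

lemma enters_merge:
  assumes "0 < n" "(F a b ^^ n) p = F a b q" "enters a b q"
  shows "enters a b p"
proof -
  obtain m where "(F a b ^^ Suc m) q \<in> Theta a b"
    using assms(3) gr0_conv_Suc by (auto simp: enters_def)
  then have "(F a b ^^ m) (F a b q) \<in> Theta a b"
    by (simp add: funpow_swap1)
  then show ?thesis
    using assms(1,2) by (intro enters_via[OF assms(1,2)]) (cases m; auto simp: enters_def)
qed

lemma funpow_off_diag: "p \<in> off_diag \<Longrightarrow> (F a b ^^ n) p \<in> off_diag"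
  by (induction n) (auto intro: F_off_diag)

lemma same_sign_iff: "sgn (x :: real) = sgn y \<longleftrightarrow> 0 < x * y \<or> x = 0 \<and> y = 0"
  by (auto simp: sgn_if zero_less_mult_iff split: if_splits)

lemma descend:
  assumes ab: "(a, b) \<in> params" and "b \<le> t"
  obtains n where "0 < n" "b - 1 \<le> t - real n" "t - real n < b"
    "\<And>x. (F a b ^^ n) (x, Some t) = (translate (- real n) x, Some (t - real n))"
proof -
  define n where "n = nat \<lfloor>t - b\<rfloor> + 1"
  have n: "real n = of_int \<lfloor>t - b\<rfloor> + 1"
    using assms by (simp add: n_def)
  have "(F a b ^^ k) (x, Some t) = (translate (- real k) x, Some (t - real k))" if "k \<le> n" for k x
    using that
  proof (induction k)
    case (Suc k)
    have "k \<le> nat \<lfloor>t - b\<rfloor>" using Suc.prems by (simp add: n_def)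
    then have "real k \<le> of_int \<lfloor>t - b\<rfloor>"
      using assms by linarith
    then have "b \<le> t - real k" by linarith
    then show ?case
      using Suc paramsD(5)[OF ab] by (simp add: F_high algebra_simps)
  qed simp
  moreover have "b - 1 \<le> t - real n" "t - real n < b" "0 < n"
    using n by (linarith, linarith, simp add: n_def)
  ultimately show thesis
    using that[of n] by blast
qed

lemma ascend:
  assumes "t < a"
  obtains n where "0 < n" "a \<le> t + real n" "t + real n < a + 1"
    "\<And>x. (F a b ^^ n) (x, Some t) = (translate (real n) x, Some (t + real n))"
proof -
  define n where "n = nat \<lceil>a - t\<rceil>"
  have n: "real n = of_int \<lceil>a - t\<rceil>"
    using assms by (simp add: n_def)
  have "(F a b ^^ k) (x, Some t) = (translate (real k) x, Some (t + real k))" if "k \<le> n" for k x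
    using that
  proof (induction k)
    case (Suc k)
    then have "int k < \<lceil>a - t\<rceil>" by (simp add: n_def)
    then have "t + real k < a" by (simp add: less_ceiling_iff)
    then show ?case
      using Suc by (simp add: F_low algebra_simps)
  qed simp
  moreover have "a \<le> t + real n" "t + real n < a + 1" "0 < n"
    using n assms by (linarith, linarith, simp add: n_def)
  ultimately show thesis
    using that[of n] by blast
qed

text \<open>After inverting a point with \<open>y = t\<close>, the map shifts in the direction of \<open>sgn t\<close> until \<open>y\<close> is
  back in \<open>[a, b)\<close>, more precisely in \<open>[a, a + 1)\<close> for \<open>t > 0\<close> and in \<open>[b - 1, b)\<close> for \<open>t < 0\<close>. At
  such a height, a point of the plane with \<open>x\<close> at distance at least \<open>1\<close> from \<open>0\<close> on the side of
  \<open>sgn t\<close>, or at \<open>\<infinity>\<close>, lies in the outer rectangle of the lower or upper part. Phrasing this with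
  \<open>sgn t\<close> treats both halves of the plane at once.\<close>

lemma first_return:
  assumes ab: "(a, b) \<in> params" and t: "a \<le> t" "t < b" "t \<noteq> 0"
  obtains n N :: nat and y where "0 < n" "0 < N" "y = sgn t * real n - 1 / t" "a \<le> y" "y < b" "sgn t * y \<le> 1"
    "\<And>x. (F a b ^^ N) (x, Some t) = (translate (sgn t * real n) (neg_recip x), Some y)"
    "\<And>x. x \<noteq> Some y \<Longrightarrow> x = None \<or> (\<exists>r. x = Some r \<and> 1 \<le> sgn t * r) \<Longrightarrow> (x, Some y) \<in> Theta a b"
proof (cases "0 < t")
  case True
  have "- 1 / t < a"
  proof -
    have "- 1 / t < - 1 / b" using True t by (simp add: field_simps)
    then show ?thesis using paramsD(7)[OF ab] True t by linarith
  qed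
  then obtain n where n: "0 < n" "a \<le> - 1 / t + real n" "- 1 / t + real n < a + 1"
    "\<And>x. (F a b ^^ n) (x, Some (- 1 / t)) = (translate (real n) x, Some (- 1 / t + real n))"
    using ascend by metis
  show thesis
  proof (rule that[of n "Suc n" "real n - 1 / t"])
    show "(F a b ^^ Suc n) (x, Some t) = (translate (sgn t * real n) (neg_recip x), Some (real n - 1 / t))" for x
      using n(4)[of "neg_recip x"] True t by (simp add: funpow_swap1 F_middle)
    show "(x, Some (real n - 1 / t)) \<in> Theta a b"
      if "x \<noteq> Some (real n - 1 / t)" "x = None \<or> (\<exists>r. x = Some r \<and> 1 \<le> sgn t * r)" for x
      using that True t n(3) by (auto simp: Theta_def mem_Theta_l_iff)
  qed (use n True t paramsD[OF ab] in auto)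
next
  case False
  then have "t < 0" using t by simp
  have "b \<le> - 1 / t"
  proof -
    have "- 1 / a \<le> - 1 / t" using \<open>t < 0\<close> t by (simp add: field_simps)
    then show ?thesis using paramsD(6)[OF ab] \<open>t < 0\<close> t by linarith
  qed
  then obtain n where n: "0 < n" "b - 1 \<le> - 1 / t - real n" "- 1 / t - real n < b"
    "\<And>x. (F a b ^^ n) (x, Some (- 1 / t)) = (translate (- real n) x, Some (- 1 / t - real n))"
    using descend[OF ab] by metis
  show thesis
  proof (rule that[of n "Suc n" "- real n - 1 / t"])
    show "(F a b ^^ Suc n) (x, Some t) = (translate (sgn t * real n) (neg_recip x), Some (- real n - 1 / t))" for x
      using n(4)[of "neg_recip x"] \<open>t < 0\<close> t by (simp add: funpow_swap1 F_middle algebra_simps)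
    show "(x, Some (- real n - 1 / t)) \<in> Theta a b"
      if "x \<noteq> Some (- real n - 1 / t)" "x = None \<or> (\<exists>r. x = Some r \<and> 1 \<le> sgn t * r)" for x
      using that \<open>t < 0\<close> t n(2) by (auto simp: Theta_def mem_Theta_u_iff)
  qed (use n \<open>t < 0\<close> t paramsD[OF ab] in auto)
qed

text \<open>The inversion sends \<open>x\<close> to the side of \<open>sgn t\<close> (or to \<open>0\<close> or \<open>\<infinity>\<close>), and the shifts then move it
  by at least \<open>1\<close> further in this direction.\<close>

lemma enters_if_not_same_sign:
  assumes ab: "(a, b) \<in> params" and t: "a \<le> t" "t < b" "t \<noteq> 0"
    and x: "x \<noteq> Some t" "\<And>r. x = Some r \<Longrightarrow> r * t \<le> 0"
  shows "enters a b (x, Some t)"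
proof -
  obtain n N :: nat and y where N: "0 < n" "0 < N"
    "(F a b ^^ N) (x, Some t) = (translate (sgn t * real n) (neg_recip x), Some y)"
    and Theta: "\<And>x. x \<noteq> Some y \<Longrightarrow> x = None \<or> (\<exists>r. x = Some r \<and> 1 \<le> sgn t * r)
      \<Longrightarrow> (x, Some y) \<in> Theta a b"
    using first_return[OF ab t] by metis
  let ?x = "translate (sgn t * real n) (neg_recip x)"
  have "?x \<noteq> Some y"
    using funpow_off_diag[of "(x, Some t)" N a b] x(1) N(3) by simp
  moreover have "?x = None \<or> (\<exists>r. ?x = Some r \<and> 1 \<le> sgn t * r)"
  proof (cases x)
    case None
    then show ?thesis using N(1) t by (auto simp: sgn_if)
  next
    case (Some r)
    then have r: "r * t \<le> 0" using x(2) by simp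
    show ?thesis
    proof (cases "r = 0")
      case True
      then show ?thesis using Some by simp
    next
      case False
      have "sgn t * (1 / r) \<le> 0"
        using r t False by (auto simp: sgn_if mult_le_0_iff divide_le_0_iff zero_le_divide_iff)
      moreover have "sgn t * (- 1 / r + sgn t * real n) = real n - sgn t * (1 / r)"
        using t by (auto simp: sgn_if)
      ultimately have "1 \<le> sgn t * (- 1 / r + sgn t * real n)"
        using N(1) by linarith
      then show ?thesis using Some False by simp
    qed
  qed
  ultimately show ?thesis
    using Theta N by (intro enters_via[OF N(2,3)]) blast
qed

text \<open>The height \<open>\<infinity>\<close> is fixed, and \<open>x\<close> decreases until it is at most \<open>-1\<close>, in the outer
  rectangle of the upper part.\<close>

lemma enters_infinity:
  assumes "a \<noteq> 0"
  shows "enters a b (Some r, None)"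
proof -
  have iter: "(F a b ^^ n) (Some r, None) = (Some (r - real n), None)" for n
    by (induction n) (auto simp: F_infinity)
  obtain n where n: "r + 1 \<le> real n" using real_arch_simple by blast
  have "(Some (r - real (Suc n)), None) \<in> Theta a b"
    using n assms by (simp add: Theta_def mem_Theta_u_iff)
  then show ?thesis
    using enters_via[OF _ iter[of "Suc n"]] by blast
qed

text \<open>The height \<open>0\<close> is inverted to \<open>\<infinity>\<close>. For \<open>a = 0\<close> there is no upper part to decrease into, and the
  inverted point is outside the lower part exactly for \<open>0 < x < 1\<close>, when the original point is
  stray.\<close>

lemma enters_zero:
  assumes ab: "(a, b) \<in> params" and "0 < b" and x: "x \<noteq> Some 0"
  shows "enters a b (x, Some 0) \<or> (x, Some 0) \<in> Theta a b \<inter> stray a"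
proof -
  have step: "(F a b ^^ 1) (x, Some 0) = (neg_recip x, None)"
    using assms paramsD[OF ab] by (simp add: F_middle)
  obtain r where r: "neg_recip x = Some r"
    using x by (cases x rule: neg_recip.cases) auto
  show ?thesis
  proof (cases "a = 0 \<and> r < - 1")
    case False
    then have "(Some r, None) \<in> Theta a b \<or> enters a b (Some r, None)"
      using enters_infinity[of a b r] \<open>0 < b\<close> by (force simp: Theta_def mem_Theta_l_iff)
    then show ?thesis
      using enters_via[OF _ step] r by simp
  next
    case True
    have "x = neg_recip (Some r)" using r by (metis neg_recip_neg_recip)
    then have "x = Some (- 1 / r)" "0 < - 1 / r" "- 1 / r < 1"
      using True by (auto simp: field_simps)
    then show ?thesis
      using True \<open>0 < b\<close> by (auto simp: Theta_def mem_Theta_l_iff stray_def)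
  qed
qed

text \<open>Put \<open>s = sgn t\<close>. At the first return, \<open>s x = n - 1/|r|\<close> is at least \<open>1\<close> unless \<open>n = 1\<close>, while
  for \<open>n = 1\<close> it is nonnegative and \<open>s y = 1 - 1/|t|\<close> is not positive: the point has lost the
  common sign of its coordinates.\<close>

lemma enters_if_large:
  assumes ab: "(a, b) \<in> params" and t: "a \<le> t" "t < b" "t \<noteq> 0" "\<bar>t\<bar> \<le> 1"
    and r: "1 \<le> \<bar>r\<bar>" "0 < r * t" "r \<noteq> t"
  shows "enters a b (Some r, Some t)"
proof -
  obtain n N :: nat and y where N: "0 < n" "0 < N" "y = sgn t * real n - 1 / t" "a \<le> y" "y < b"
    "\<And>x. (F a b ^^ N) (x, Some t) = (translate (sgn t * real n) (neg_recip x), Some y)"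
    and Theta: "\<And>x. x \<noteq> Some y \<Longrightarrow> x = None \<or> (\<exists>r. x = Some r \<and> 1 \<le> sgn t * r)
      \<Longrightarrow> (x, Some y) \<in> Theta a b"
    using first_return[OF ab t(1-3)] by metis
  define x where "x = sgn t * real n - 1 / r"
  have "r \<noteq> 0" using r by auto
  then have step: "(F a b ^^ N) (Some r, Some t) = (Some x, Some y)"
    using N(6)[of "Some r"] by (simp add: x_def)
  have "x \<noteq> y"
    using funpow_off_diag[of "(Some r, Some t)" N a b] r(3) step by simp
  have s: "sgn t * x = real n - 1 / \<bar>r\<bar>" "sgn t * y = real n - 1 / \<bar>t\<bar>"
    using r(2) t(3) by (auto simp: x_def N(3) sgn_if zero_less_mult_iff algebra_simps)
  have "1 / \<bar>r\<bar> \<le> 1" "1 \<le> 1 / \<bar>t\<bar>" using r t by simp_all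
  show ?thesis
  proof (cases "1 \<le> sgn t * x")
    case True
    then show ?thesis
      using Theta[of "Some x"] \<open>x \<noteq> y\<close> enters_via[OF N(2) step] by blast
  next
    case False
    then have "n = 1"
      using s \<open>1 / \<bar>r\<bar> \<le> 1\<close> N(1) by linarith
    then have "0 \<le> sgn t * x" "sgn t * y \<le> 0"
      using s \<open>1 / \<bar>r\<bar> \<le> 1\<close> \<open>1 \<le> 1 / \<bar>t\<bar>\<close> by simp_all
    then have "x * y \<le> 0"
      using t(3) by (auto simp: sgn_if mult_le_0_iff split: if_splits)
    then have "enters a b (Some x, Some y) \<or> (Some x, Some y) \<in> Theta a b"
      using enters_if_not_same_sign[OF ab N(4,5), of "Some x"] enters_zero[OF ab, of "Some x"] \<open>x \<noteq> y\<close> N(4,5)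
      by (cases "y = 0") auto
    then show ?thesis using enters_via[OF N(2) step] by blast
  qed
qed

text \<open>In the modular group, with \<open>S\<close> the inversion and \<open>T\<close> the shift, this is \<open>(T S)\<^sup>2 = S T\<^sup>-\<^sup>1\<close> and
  its mirror image, that is, the relation \<open>(S T)\<^sup>3 = 1\<close>.\<close>

lemma neg_recip_translate_relation:
  assumes "s = 1 \<or> s = - 1"
  shows "translate s (neg_recip (translate s (neg_recip x))) = neg_recip (translate (- s) x)"
  using assms by (cases x rule: neg_recip.cases) (auto simp: field_simps)

text \<open>A height in \<open>[a, b)\<close> beyond \<open>1\<close> or \<open>-1\<close> is inverted, although shifting it towards \<open>0\<close> would be
  more natural. By the modular relation both choices lead to the same orbit in the end.\<close>

lemma F_four_steps:
  assumes ab: "(a, b) \<in> params" and t: "a \<le> t" "t < b" "1 < \<bar>t\<bar>"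
  shows "(F a b ^^ 4) (x, Some t) = F a b (translate (- sgn t) x, Some (t - sgn t))"
proof -
  note P = paramsD[OF ab]
  have four: "(F a b ^^ 4) p = F a b (F a b (F a b (F a b p)))" for p
    by (simp add: numeral_eq_Suc)
  note rel = neg_recip_translate_relation[OF disjI1, OF refl]
    neg_recip_translate_relation[OF disjI2, OF refl]
  show ?thesis
  proof (cases "0 < t")
    case True
    then have "1 < t" using t by simp
    then have "- 1 / t < - 1 / b" "- 1 / b \<le> a" "- 1 < - 1 / b"
      using t P by (auto simp: field_simps)
    then have low: "- 1 / t < a" "- 1 < a" by linarith+
    define u where "u = - 1 / t + 1"
    have u: "0 < u" "u < 1" using \<open>1 < t\<close> by (auto simp: u_def)
    then have "- 1 / u < - 1" by (simp add: field_simps)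
    then have "- 1 / u < a" using low(2) by linarith
    have y: "neg_recip (Some t) = Some (- 1 / t)" "translate 1 (Some (- 1 / t)) = Some u"
      "neg_recip (Some u) = Some (- 1 / u)"
      using t(3) u by (auto simp: u_def)
    have "a \<le> u" "u < b" using u t P(1) \<open>1 < t\<close> by linarith+
    then have "F a b (x', Some t) = (neg_recip x', Some (- 1 / t))"
      "F a b (x', Some (- 1 / t)) = (translate 1 x', Some u)"
      "F a b (x', Some u) = (neg_recip x', Some (- 1 / u))"
      "F a b (x', Some (- 1 / u)) = (translate 1 x', translate 1 (Some (- 1 / u)))" for x'
      using F_middle[OF t(1,2), where x = x'] F_low[OF low(1), where x = x'] F_middle[of a u b, where x = x'] F_low[OF \<open>- 1 / u < a\<close>, where x = x'] y
      by (simp_all only: translate_simps diff_conv_add_uminus)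
    then have "(F a b ^^ 4) (x, Some t) = (translate 1 (neg_recip (translate 1 (neg_recip x))),
        translate 1 (neg_recip (translate 1 (neg_recip (Some t)))))"
      by (simp only: four y)
    also have "\<dots> = F a b (translate (- sgn t) x, Some (t - sgn t))"
      using t \<open>1 < t\<close> P(1) by (simp only: rel) (simp add: F_middle)
    finally show ?thesis .
  next
    case False
    then have "t < - 1" using t by simp
    then have "- 1 / a \<le> - 1 / t" "b \<le> - 1 / a" "- 1 / a < 1"
      using t P by (auto simp: field_simps)
    then have high: "b \<le> - 1 / t" "b < 1" by linarith+
    define u where "u = - 1 / t - 1"
    have u: "u < 0" "- 1 < u" using \<open>t < - 1\<close> by (auto simp: u_def field_simps)
    then have "1 < - 1 / u" by (simp add: field_simps)
    then have "b \<le> - 1 / u" using high(2) by linarith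
    have y: "neg_recip (Some t) = Some (- 1 / t)" "translate (- 1) (Some (- 1 / t)) = Some u"
      "neg_recip (Some u) = Some (- 1 / u)"
      using t(3) u by (auto simp: u_def)
    have "a \<le> u" "u < b" using u t P(2) \<open>t < - 1\<close> by linarith+
    then have "F a b (x', Some t) = (neg_recip x', Some (- 1 / t))"
      "F a b (x', Some (- 1 / t)) = (translate (- 1) x', Some u)"
      "F a b (x', Some u) = (neg_recip x', Some (- 1 / u))"
      "F a b (x', Some (- 1 / u)) = (translate (- 1) x', translate (- 1) (Some (- 1 / u)))" for x'
      using F_middle[OF t(1,2), where x = x'] F_high[OF less_imp_le[OF P(5)] high(1), where x = x'] F_middle[of a u b, where x = x'] F_high[OF less_imp_le[OF P(5)] \<open>b \<le> - 1 / u\<close>, where x = x'] y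
      by (simp_all only: translate_simps diff_conv_add_uminus)
    then have "(F a b ^^ 4) (x, Some t) = (translate (- 1) (neg_recip (translate (- 1) (neg_recip x))),
        translate (- 1) (neg_recip (translate (- 1) (neg_recip (Some t)))))"
      by (simp only: four y)
    also have "\<dots> = F a b (translate (- sgn t) x, Some (t - sgn t))"
      using t \<open>t < - 1\<close> P(2) by (simp only: rel) (simp add: F_middle)
    finally show ?thesis .
  qed
qed

text \<open>Consequently, heights in \<open>[a, b)\<close> can be shifted into \<open>[-1, 1]\<close> before they are studied further.
  The shifted points need not be on the orbit of the original one, but their futures agree.\<close>

lemma shift_to_unit_interval:
  assumes ab: "(a, b) \<in> params" and t: "a \<le> t" "t < b" "t \<noteq> 0"
  obtains k where "\<bar>t\<bar> \<le> 1 \<Longrightarrow> k = (0 :: nat)"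
    "a \<le> t - sgn t * real k" "t - sgn t * real k < b"
    "t - sgn t * real k \<noteq> 0" "\<bar>t - sgn t * real k\<bar> \<le> 1"
    "\<And>x. enters a b (translate (- sgn t * real k) x, Some (t - sgn t * real k))
        \<Longrightarrow> enters a b (x, Some t)"
proof -
  \<comment> \<open>The largest number of unit shifts that do not change the sign of \<open>t\<close>.\<close>
  define k where "k = nat (\<lceil>\<bar>t\<bar>\<rceil> - 1)"
  have pos: "0 < \<lceil>\<bar>t\<bar>\<rceil>" using t by simp
  then have k: "real k = of_int \<lceil>\<bar>t\<bar>\<rceil> - 1"
    by (simp add: k_def)
  then have bounds: "real k < \<bar>t\<bar>" "\<bar>t\<bar> \<le> real k + 1"
    by linarith+
  have range: "a \<le> t - sgn t * real j \<and> t - sgn t * real j < b \<and> \<bar>t - sgn t * real j\<bar> = \<bar>t\<bar> - real j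
      \<and> sgn (t - sgn t * real j) = sgn t" if "real j < \<bar>t\<bar>" for j
    using that t paramsD(1,2)[OF ab] by (auto simp: sgn_if split: if_splits)
  have "enters a b (x, Some t)"
    if "j \<le> k" "enters a b (translate (- sgn t * real j) x, Some (t - sgn t * real j))" for j x
    using that
  proof (induction j)
    case (Suc j)
    let ?t = "t - sgn t * real j"
    have j: "real j < \<bar>t\<bar>" "1 < \<bar>t\<bar> - real j" using Suc.prems(1) bounds by linarith+
    note r = range[OF j(1)]
    have "(F a b ^^ 4) (translate (- sgn t * real j) x, Some ?t)
        = F a b (translate (- sgn t * real (Suc j)) x, Some (t - sgn t * real (Suc j)))"
      using F_four_steps[OF ab, of ?t] r j(2) by (simp add: algebra_simps)
    then have "enters a b (translate (- sgn t * real j) x, Some ?t)"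
      using enters_merge[OF _ _ Suc.prems(2), of 4] by simp
    then show ?case using Suc by simp
  qed simp
  moreover have "k = 0" if "\<bar>t\<bar> \<le> 1"
    using that bounds by simp
  moreover have "t - sgn t * real k \<noteq> 0" "\<bar>t - sgn t * real k\<bar> \<le> 1"
    using range[OF bounds(1)] bounds by auto
  ultimately show thesis
    using that[of k] range[OF bounds(1)] by blast
qed

text \<open>The points that remain lie in the square \<open>[-1, 1]\<^sup>2\<close> and have coordinates of the same sign. A
  first return followed by a shift into the unit interval subtracts \<open>1/r\<close> and \<open>1/t\<close> from a common
  integer, and by the preceding lemmas the result is again such a point, unless it enters the
  region.\<close>

lemma same_sign_step:
  assumes ab: "(a, b) \<in> params" and t: "a \<le> t" "t < b" "\<bar>t\<bar> \<le> 1"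
    and r: "\<bar>r\<bar> < 1" "0 < r * t" "r \<noteq> t"
    and not: "\<not> enters a b (Some r, Some t)"
  obtains n r' t' where "0 < n" "r' = sgn r * real n - 1 / r" "t' = sgn r * real n - 1 / t"
    "a \<le> t'" "t' < b" "\<bar>t'\<bar> \<le> 1" "\<bar>r'\<bar> < 1" "0 < r' * t'" "r' \<noteq> t'"
    "\<not> enters a b (Some r', Some t')"
proof -
  have nz: "r \<noteq> 0" "t \<noteq> 0" and sgn: "sgn r = sgn t"
    using r(2) by (auto simp: same_sign_iff)
  obtain n N :: nat and y where N: "0 < n" "0 < N" "y = sgn t * real n - 1 / t" "a \<le> y" "y < b" "sgn t * y \<le> 1"
    "\<And>x. (F a b ^^ N) (x, Some t) = (translate (sgn t * real n) (neg_recip x), Some y)"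
    using first_return[OF ab t(1,2) nz(2)] by metis
  define x where "x = sgn t * real n - 1 / r"
  have step: "(F a b ^^ N) (Some r, Some t) = (Some x, Some y)"
    using N(7)[of "Some r"] nz by (simp add: x_def)
  have "x \<noteq> y"
    using funpow_off_diag[of "(Some r, Some t)" N a b] r(3) step by simp
  have notxy: "\<not> enters a b (Some x, Some y)" "(Some x, Some y) \<notin> Theta a b"
    using enters_via[OF N(2) step] not by blast+
  have "y \<noteq> 0"
    using enters_zero[OF ab, of "Some x"] N(4,5) notxy \<open>x \<noteq> y\<close> by auto
  then obtain k where k: "\<bar>y\<bar> \<le> 1 \<Longrightarrow> k = 0"
    "a \<le> y - sgn y * real k" "y - sgn y * real k < b"
    "y - sgn y * real k \<noteq> 0" "\<bar>y - sgn y * real k\<bar> \<le> 1"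
    "\<And>x. enters a b (translate (- sgn y * real k) x, Some (y - sgn y * real k))
        \<Longrightarrow> enters a b (x, Some y)"
    using shift_to_unit_interval[OF ab N(4,5)] by metis
  \<comment> \<open>A height beyond the unit interval is on the side opposite to \<open>t\<close>, so both shifts have the same direction.\<close>
  have dir: "sgn y * real k = - sgn t * real k"
  proof (cases "\<bar>y\<bar> \<le> 1")
    case False
    then have "sgn y = - sgn t"
      using N(6) nz by (auto simp: sgn_if split: if_splits)
    then show ?thesis by simp
  qed (use k(1) in simp)
  define r' t' where "r' = sgn r * real (n + k) - 1 / r" and "t' = sgn r * real (n + k) - 1 / t"
  have eqs: "r' = x - sgn y * real k" "t' = y - sgn y * real k"
    unfolding dir r'_def t'_def x_def sgn by (simp_all add: N(3) algebra_simps)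
  have not': "\<not> enters a b (Some r', Some t')"
    using k(6)[of "Some x"] notxy eqs by auto
  have "r' \<noteq> t'" using \<open>x \<noteq> y\<close> eqs by simp
  have t': "a \<le> t'" "t' < b" "t' \<noteq> 0" "\<bar>t'\<bar> \<le> 1" using k(2-5) eqs by simp_all
  have "0 < r' * t'"
    using enters_if_not_same_sign[OF ab t'(1-3), of "Some r'"] not' \<open>r' \<noteq> t'\<close> by force
  moreover have "\<bar>r'\<bar> < 1"
    using enters_if_large[OF ab t', of r'] not' \<open>r' \<noteq> t'\<close> \<open>0 < r' * t'\<close> by force
  ultimately show thesis
    using that[of "n + k" r' t'] N(1) r'_def t'_def t' not' \<open>r' \<noteq> t'\<close> by simp
qed

text \<open>The difference of the coordinates is divided by \<open>r t\<close>.\<close>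

lemma step_expansion:
  fixes r t c :: real
  assumes "0 < r * t" "\<bar>r\<bar> \<le> 1" "\<bar>t\<bar> \<le> 1"
  defines "d \<equiv> \<bar>(c - 1 / r) - (c - 1 / t)\<bar>"
  shows "\<bar>r - t\<bar> \<le> d" and "\<bar>r\<bar> \<le> 2 / 3 \<Longrightarrow> 3 / 2 * \<bar>r - t\<bar> \<le> d"
proof -
  have "r \<noteq> 0" "t \<noteq> 0" using assms by auto
  then have eq: "d * \<bar>r * t\<bar> = \<bar>r - t\<bar>"
    by (simp add: d_def abs_mult [symmetric] field_simps)
  have "0 \<le> d" by (simp add: d_def)
  have "\<bar>r * t\<bar> \<le> \<bar>r\<bar>"
    using assms by (simp add: abs_mult mult_left_le)
  then have le: "\<bar>r - t\<bar> \<le> d * \<bar>r\<bar>"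
    using mult_left_mono[OF _ \<open>0 \<le> d\<close>] eq by metis
  show "\<bar>r - t\<bar> \<le> d"
    using le mult_left_mono[OF assms(2) \<open>0 \<le> d\<close>] by simp
  show "3 / 2 * \<bar>r - t\<bar> \<le> d" if "\<bar>r\<bar> \<le> 2 / 3"
    using le mult_left_mono[OF that \<open>0 \<le> d\<close>] by simp
qed

text \<open>The expansion of \<open>step_expansion\<close> degenerates only near the parabolic fixed points \<open>\<plusminus>1\<close> of
  \<open>r \<mapsto> \<plusminus>2 - 1/r\<close>. While \<open>r\<close> stays near one of them, \<open>1/(1 - |r|)\<close> decreases by \<open>1\<close> in each step,
  so this cannot last.\<close>

lemma parabolic_step:
  fixes r :: real
  assumes r: "2 / 3 < \<bar>r\<bar>" "\<bar>r\<bar> < 1" and "0 < n"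
    and r': "r' = sgn r * real n - 1 / r" "\<bar>r'\<bar> < 1" "2 / 3 < \<bar>r'\<bar>"
  shows "1 / (1 - \<bar>r'\<bar>) = 1 / (1 - \<bar>r\<bar>) - 1"
proof -
  have eq: "sgn r * r' = real n - 1 / \<bar>r\<bar>"
    using r by (auto simp: r' sgn_if algebra_simps)
  have abs: "\<bar>sgn r * r'\<bar> = \<bar>r'\<bar>"
    using r by (auto simp: abs_mult sgn_if)
  have bounds: "1 < 1 / \<bar>r\<bar>" "1 / \<bar>r\<bar> < 3 / 2"
    using r by (auto simp: divide_simps)
  have "real n < 3" "real n \<noteq> 1"
    using eq abs bounds r' by linarith+
  then have "n = 2" using \<open>0 < n\<close> by linarith
  then have "\<bar>r'\<bar> = 2 - 1 / \<bar>r\<bar>"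
    using eq abs bounds by linarith
  then have "1 - \<bar>r'\<bar> = (1 - \<bar>r\<bar>) / \<bar>r\<bar>"
    using r by (simp add: diff_divide_distrib)
  then show ?thesis
    unfolding \<open>1 - \<bar>r'\<bar> = _\<close> using r by (simp add: field_simps)
qed

text \<open>An orbit that always keeps the common sign would expand \<open>|r - t|\<close> by the factor \<open>3/2\<close> infinitely
  often and never decrease it, whereas \<open>|r - t| < 1\<close> for such points.\<close>

lemma enters_if_same_sign:
  assumes ab: "(a, b) \<in> params" and "a \<le> t" "t < b" "\<bar>t\<bar> \<le> 1" "\<bar>r\<bar> < 1" "0 < r * t" "r \<noteq> t"
  shows "enters a b (Some r, Some t)"
proof -
  define bad where "bad r t \<longleftrightarrow> a \<le> t \<and> t < b \<and> \<bar>t\<bar> \<le> 1 \<and> \<bar>r\<bar> < 1 \<and> 0 < r * t \<and> r \<noteq> t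
    \<and> \<not> enters a b (Some r, Some t)" for r t
  have step: "\<exists>n r' t'. 0 < n \<and> r' = sgn r * real n - 1 / r \<and> bad r' t' \<and> \<bar>r - t\<bar> \<le> \<bar>r' - t'\<bar>
      \<and> (\<bar>r\<bar> \<le> 2 / 3 \<longrightarrow> 3 / 2 * \<bar>r - t\<bar> \<le> \<bar>r' - t'\<bar>)" if bad: "bad r t" for r t
  proof -
    have "a \<le> t" "t < b" "\<bar>t\<bar> \<le> 1" "\<bar>r\<bar> < 1" "0 < r * t" "r \<noteq> t" "\<not> enters a b (Some r, Some t)"
      using bad by (auto simp: bad_def)
    then obtain n r' t' where 1: "0 < n" "r' = sgn r * real n - 1 / r"
      and t': "t' = sgn r * real n - 1 / t" and 2: "bad r' t'"
      using same_sign_step[OF ab] unfolding bad_def by metis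
    have "\<bar>r - t\<bar> \<le> \<bar>r' - t'\<bar> \<and> (\<bar>r\<bar> \<le> 2 / 3 \<longrightarrow> 3 / 2 * \<bar>r - t\<bar> \<le> \<bar>r' - t'\<bar>)"
      unfolding 1(2) t' using step_expansion[of r t "sgn r * real n"]
        \<open>0 < r * t\<close> \<open>\<bar>r\<bar> < 1\<close> \<open>\<bar>t\<bar> \<le> 1\<close> by linarith
    then show ?thesis
      using 1 2 by blast
  qed
  \<comment> \<open>The outer induction counts the expansions that are possible before \<open>|r - t|\<close> exceeds \<open>1\<close>, the inner one the steps near a parabolic point.\<close>
  have not_bad: "\<not> bad r t" if "(2 / 3) ^ k < \<bar>r - t\<bar>" for k r t
    using that
  proof (induction k arbitrary: r t)
    case 0
    then show ?case
      by (auto simp: bad_def zero_less_mult_iff)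
  next
    case (Suc k)
    have small: "\<not> bad r t" if d: "(2 / 3) ^ Suc k < \<bar>r - t\<bar>" and r: "\<bar>r\<bar> \<le> 2 / 3" for r t
    proof
      assume "bad r t"
      then obtain r' t' where "bad r' t'" "3 / 2 * \<bar>r - t\<bar> \<le> \<bar>r' - t'\<bar>"
        using step r by blast
      moreover have "(2 / 3) ^ k < 3 / 2 * \<bar>r - t\<bar>" using d by simp
      ultimately show False using Suc.IH[of r' t'] by linarith
    qed
    have "\<not> bad r t" if "(2 / 3) ^ Suc k < \<bar>r - t\<bar>" "1 / (1 - \<bar>r\<bar>) \<le> real m" for m r t
      using that
    proof (induction m arbitrary: r t)
      case 0
      then show ?case by (auto simp: bad_def divide_le_0_iff)
    next
      case (Suc m)
      show ?case
      proof
        assume bad: "bad r t"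
        then have r: "2 / 3 < \<bar>r\<bar>" "\<bar>r\<bar> < 1"
          using small[OF Suc.prems(1)] not_le by (blast, simp add: bad_def)
        obtain n r' t' where 1: "0 < n" "r' = sgn r * real n - 1 / r" "bad r' t'"
          "\<bar>r - t\<bar> \<le> \<bar>r' - t'\<bar>"
          using step[OF bad] by blast
        then have d: "(2 / 3) ^ Suc k < \<bar>r' - t'\<bar>" using Suc.prems(1) by linarith
        have "2 / 3 < \<bar>r'\<bar>" "\<bar>r'\<bar> < 1"
          using small[OF d] 1(3) not_le by (blast, simp add: bad_def)
        then have "1 / (1 - \<bar>r'\<bar>) = 1 / (1 - \<bar>r\<bar>) - 1"
          using parabolic_step[OF r 1(1,2)] by blast
        then show False
          using Suc.IH[OF d] Suc.prems(2) 1(3) by simp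
      qed
    qed
    moreover obtain m where "1 / (1 - \<bar>r\<bar>) \<le> real m" using real_arch_simple by blast
    ultimately show ?case using Suc.prems by blast
  qed
  obtain k where "(2 / 3) ^ k < \<bar>r - t\<bar>"
    using real_arch_pow_inv[of "\<bar>r - t\<bar>" "2 / 3"] assms by auto
  then show ?thesis
    using not_bad[of k r t] assms by (auto simp: bad_def)
qed

lemma enters_inversion_strip:
  assumes ab: "(a, b) \<in> params" and t: "a \<le> t" "t < b" "t \<noteq> 0" and x: "x \<noteq> Some t"
  shows "enters a b (x, Some t)"
proof -
  obtain k where k: "a \<le> t - sgn t * real k" "t - sgn t * real k < b"
    "t - sgn t * real k \<noteq> 0" "\<bar>t - sgn t * real k\<bar> \<le> 1"
    "\<And>x. enters a b (translate (- sgn t * real k) x, Some (t - sgn t * real k))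
        \<Longrightarrow> enters a b (x, Some t)"
    using shift_to_unit_interval[OF ab t] by metis
  let ?t = "t - sgn t * real k" and ?x = "translate (- sgn t * real k) x"
  have "?x \<noteq> Some ?t" using x by (cases x) auto
  then have "enters a b (?x, Some ?t)"
    using enters_if_not_same_sign[OF ab k(1-3), of ?x] enters_if_large[OF ab k(1-4)]
      enters_if_same_sign[OF ab k(1,2,4)]
    by (metis not_le)
  then show ?thesis using k(5) by blast
qed

text \<open>Every finite height is shifted into \<open>[a, b)\<close>. There a point with height \<open>0\<close> may be one of the
  exceptional points that lie in the region but do not return to it, so this possibility is kept
  until the shifted point is seen to lie in the region.\<close>

lemma enters_all:
  assumes ab: "(a, b) \<in> params" and "p \<in> off_diag" "p \<notin> stray a"
  shows "enters a b p"
proof -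
  note P = paramsD[OF ab]
  have strip: "enters a b (x, Some t) \<or> (x, Some t) \<in> Theta a b \<inter> stray a"
    if "a \<le> t" "t < b" "x \<noteq> Some t" for x t
    using that enters_zero[OF ab] enters_inversion_strip[OF ab] by (cases "t = 0") auto
  obtain x y where p: "p = (x, y)" "x \<noteq> y" using assms by (cases p) auto
  show ?thesis
  proof (cases y)
    case None
    then obtain r where r: "x = Some r" using p by auto
    show ?thesis
    proof (cases "a = 0")
      case False
      then show ?thesis using enters_infinity[of a b r] p None r by simp
    next
      case True
      then have "0 \<le> r" using assms p None r by (auto simp: stray_def)
      moreover have "(F a b ^^ 1) p = (Some (r - 1), None)"
        by (simp add: p None r F_infinity)
      moreover have "(Some (r - 1), None) \<in> Theta a b"
        using True P(3) \<open>0 \<le> r\<close> by (auto simp: Theta_def mem_Theta_l_iff)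
      ultimately show ?thesis using enters_via[of 1] by auto
    qed
  next
    case (Some t)
    consider "t < a" | "a \<le> t" "t < b" | "b \<le> t" by linarith
    then show ?thesis
    proof cases
      case 1
      then obtain n where n: "0 < n" "a \<le> t + real n" "t + real n < a + 1"
        "(F a b ^^ n) p = (translate (real n) x, Some (t + real n))"
        using ascend p Some by metis
      moreover have "translate (real n) x \<noteq> Some (t + real n)"
        using p Some by (cases x) auto
      ultimately show ?thesis
        using strip[of "t + real n"] P(3) by (intro enters_via[OF n(1,4)]) auto
    next
      case 2
      then show ?thesis using strip[of t x] assms p Some by blast
    next
      case 3
      then obtain n where n: "0 < n" "b - 1 \<le> t - real n" "t - real n < b"
        "(F a b ^^ n) p = (translate (- real n) x, Some (t - real n))"
        using descend[OF ab] p Some by metis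
      moreover have "translate (- real n) x \<noteq> Some (t - real n)"
        using p Some by (cases x) auto
      ultimately show ?thesis
        using strip[of "t - real n"] P(3) by (intro enters_via[OF n(1,4)]) auto
    qed
  qed
qed

theorem theorem3p1:
  fixes a b :: real
  assumes "(a, b) \<in> params"
  shows "Theta a b \<subseteq> off_diag
    \<and> connectedin rbar2_top (Theta_u a b)
    \<and> connectedin rbar2_top (Theta_l a b)
    \<and> components (planar (Theta a b)) = {planar (Theta_u a b), planar (Theta_l a b)} - {{}}
    \<and> card (components (planar (Theta a b))) = (if a = 0 \<or> b = 0 then 1 else 2)
    \<and> (\<forall>p \<in> off_diag - stray a. \<exists>N>0. (F a b ^^ N) p \<in> Theta a b)
    \<and> F a b ` (Theta a b - stray a - seam a b) \<subseteq> Theta a b"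
proof (intro conjI)
  show "Theta a b \<subseteq> off_diag"
    by (rule Theta_subset_off_diag)
  show "connectedin rbar2_top (Theta_u a b)" "connectedin rbar2_top (Theta_l a b)"
    using assms by (rule connectedin_Theta_u, rule connectedin_Theta_l)
  show "components (planar (Theta a b)) = {planar (Theta_u a b), planar (Theta_l a b)} - {{}}"
    "card (components (planar (Theta a b))) = (if a = 0 \<or> b = 0 then 1 else 2)"
    using assms by (rule components_planar_Theta)+
  show "\<forall>p \<in> off_diag - stray a. \<exists>N>0. (F a b ^^ N) p \<in> Theta a b"
    using enters_all[OF assms] unfolding enters_def by blast
  show "F a b ` (Theta a b - stray a - seam a b) \<subseteq> Theta a b"
    by (rule F_Theta_subset[OF assms])
qed

end
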